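(* Let $x\in E_4$, i.e. let $x\in(0,1)$ be irrational with all partial quotients at most $4$. Then $?'(x)$ exists and $?'(x)=+\infty$.
   Context: The Minkowski question mark function $?:[0,1]\to[0,1]$ is the continuous increasing function defined by $?(0)=0$, $?(1)=1$, by $?\left(\frac{p+p'}{q+q'}\right)=\frac12\left(?\left(\frac pq\right)+?\left(\frac{p'}{q'}\right)\right)$ for consecutive Farey fractions $\frac pq,\frac{p'}{q'}$, and extended by continuity to irrationals. Equivalently, for irrational $x=[0;a_1,a_2,\dots]$, $?(x)=\frac1{2^{a_1-1}}-\frac1{2^{a_1+a_2-1}}+\dots+\frac{(-1)^{n+1}}{2^{a_1+\dots+a_n-1}}+\cdots$. The derivative $?'(x)$ is understood as the limit of $\frac{?(x+\delta)-?(x)}{\delta}$ as $\delta\to0$ (two-sided), and the value $+\infty$ is allowed. For an integer $n\ge2$, $E_n$ is the set of irrational $x\in(0,1)$ such that in the regular continued fraction expansion $x=[0;a_1,a_2,\dots]$ all partial quotients satisfy $a_j\le n$. *)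

theory Defs
  imports "HOL-Analysis.Analysis"
begin

section \<open>Consecutive Farey fractions\<close>

text \<open>
  Fractions are kept as pairs (numerator, denominator) in lowest terms, because the mediant
  depends on this representation and not only on the value of the fraction.
\<close>

definition farey :: "int \<Rightarrow> (int \<times> int) set" where
  "farey n = {(p, q). 0 \<le> p \<and> p \<le> q \<and> 1 \<le> q \<and> q \<le> n \<and> coprime p q}"

definition farey_consecutive :: "int \<Rightarrow> int \<Rightarrow> int \<Rightarrow> int \<Rightarrow> bool" where
  "farey_consecutive p q p' q' \<longleftrightarrow>
     (\<exists>n. (p, q) \<in> farey n \<and> (p', q') \<in> farey n \<and>
          (of_int p / of_int q :: real) < of_int p' / of_int q' \<and>
          \<not> (\<exists>(r, s) \<in> farey n.
               (of_int p / of_int q :: real) < of_int r / of_int s \<and>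
               (of_int r / of_int s :: real) < of_int p' / of_int q'))"


section \<open>The Minkowski question mark function\<close>

definition is_question_mark :: "(real \<Rightarrow> real) \<Rightarrow> bool" where
  "is_question_mark f \<longleftrightarrow>
     f \<in> {0..1} \<rightarrow>\<^sub>E {0..1} \<and>
     continuous_on {0..1} f \<and>
     mono_on {0..1} f \<and>
     f 0 = 0 \<and> f 1 = 1 \<and>
     (\<forall>p q p' q'. farey_consecutive p q p' q' \<longrightarrow>
        f (of_int (p + p') / of_int (q + q')) =
          (f (of_int p / of_int q) + f (of_int p' / of_int q')) / 2)"

text \<open>
  The description is proper: see \<open>ex1_question_mark\<close> below. Outside the unit interval
  the value is \<^const>\<open>undefined\<close>.
\<close>

definition question_mark :: "real \<Rightarrow> real" where
  "question_mark = (THE f. is_question_mark f)"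


section \<open>Regular continued fractions\<close>

definition gauss_map :: "real \<Rightarrow> real" where
  "gauss_map x = frac (1 / x)"

text \<open>
  \<open>partial_quotient x j\<close> is $a_j$ in $x = [0; a_1, a_2, \dots]$, for irrational $x$ in
  the open unit interval. Indices start at 1; the value at index 0 is not meaningful.
\<close>

definition partial_quotient :: "real \<Rightarrow> nat \<Rightarrow> int" where
  "partial_quotient x j = \<lfloor>1 / (gauss_map ^^ (j - 1)) x\<rfloor>"

definition bounded_quotients :: "nat \<Rightarrow> real set" where
  "bounded_quotients n =
     {x. 0 < x \<and> x < 1 \<and> x \<notin> \<rat> \<and> (\<forall>j\<ge>1. partial_quotient x j \<le> int n)}"


section \<open>Existence and uniqueness of the question mark function\<close>

subsection \<open>Consecutive Farey fractions have determinant one\<close>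

lemma frac_less_iff:
  fixes p q r s :: int
  assumes "q > 0" "s > 0"
  shows "(of_int p / of_int q :: real) < of_int r / of_int s \<longleftrightarrow> p * s < r * q"
proof -
  have "(of_int p / of_int q :: real) < of_int r / of_int s \<longleftrightarrow>
          (of_int (p * s) :: real) < of_int (r * q)"
    using assms by (simp add: divide_simps mult.commute)
  thus ?thesis by linarith
qed

lemma det_one_imp_farey_consecutive:
  fixes p q p' q' :: int
  assumes "0 \<le> p" "p \<le> q" "1 \<le> q" "0 \<le> p'" "p' \<le> q'" "1 \<le> q'" and det: "p' * q - p * q' = 1"
  shows "farey_consecutive p q p' q'"
proof -
  define n where "n = max q q'"
  have c1: "coprime p q"
  proof (rule coprimeI)
    fix c assume "c dvd p" "c dvd q"
    hence "c dvd p' * q - p * q'" by (intro dvd_diff) auto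
    thus "is_unit c" using det by simp
  qed
  have c2: "coprime p' q'"
  proof (rule coprimeI)
    fix c assume "c dvd p'" "c dvd q'"
    hence "c dvd p' * q - p * q'" by (intro dvd_diff) auto
    thus "is_unit c" using det by simp
  qed
  have no: False if "1 \<le> s" "s \<le> n" "p * s < r * q" "r * q' < p' * s" for r s :: int
  proof -
    have "s = s * (p' * q - p * q')" using det by simp
    also have "\<dots> = q' * (r * q - p * s) + q * (p' * s - r * q')" by (simp add: algebra_simps)
    also have "\<dots> \<ge> q' * 1 + q * 1"
      using that assms by (intro add_mono mult_left_mono) auto
    finally show False using that assms unfolding n_def by linarith
  qed
  show ?thesis unfolding farey_consecutive_def
  proof (rule exI[of _ n], intro conjI)
    show "(p, q) \<in> farey n" "(p', q') \<in> farey n"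
      using assms c1 c2 by (auto simp: farey_def n_def)
    show "(of_int p / of_int q :: real) < of_int p' / of_int q'"
      using assms by (subst frac_less_iff) auto
    show "\<not> (\<exists>(r, s) \<in> farey n.
               (of_int p / of_int q :: real) < of_int r / of_int s \<and>
               (of_int r / of_int s :: real) < of_int p' / of_int q')"
    proof clarify
      fix r s assume rs: "(r, s) \<in> farey n"
        and "(of_int p / of_int q :: real) < of_int r / of_int s"
        and "(of_int r / of_int s :: real) < of_int p' / of_int q'"
      moreover have "1 \<le> s" "s \<le> n" using rs by (auto simp: farey_def)
      ultimately show False
        using no[of s r] assms by (simp add: frac_less_iff)
    qed
  qed
qed

lemma farey_consecutiveD:
  assumes "farey_consecutive p q p' q'"
  shows "0 \<le> p" "p \<le> q" "1 \<le> q" "0 \<le> p'" "p' \<le> q'" "1 \<le> q'" "p' * q - p * q' = 1"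
proof -
  from assms obtain n where n: "(p, q) \<in> farey n" "(p', q') \<in> farey n"
    and lt: "(of_int p / of_int q :: real) < of_int p' / of_int q'"
    and no: "\<not> (\<exists>(r, s) \<in> farey n.
               (of_int p / of_int q :: real) < of_int r / of_int s \<and>
               (of_int r / of_int s :: real) < of_int p' / of_int q')"
    unfolding farey_consecutive_def by auto
  show *: "0 \<le> p" "p \<le> q" "1 \<le> q" "0 \<le> p'" "p' \<le> q'" "1 \<le> q'"
    using n by (auto simp: farey_def)
  have cop: "coprime p q" "coprime p' q'" and qn: "q \<le> n" "q' \<le> n"
    using n by (auto simp: farey_def)
  have D: "p * q' < p' * q" using lt * by (simp add: frac_less_iff)
  have pq: "p < q"
  proof (rule ccontr)
    assume "\<not> p < q"
    hence "p = q" using * by simp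
    hence "q * q' < p' * q" using D by simp
    hence "q' < p'" using * by (simp add: mult.commute)
    thus False using * by simp
  qed
  obtain u v where uv: "u * q + v * p = 1"
    using bezout_int[of q p] cop by (auto simp: coprime_iff_gcd_eq_1 gcd.commute)
  define k where "k = (n + v) div q"
  define y where "y = - v + k * q"
  define x where "x = u + k * p"
  have xy: "q * x - p * y = 1" using uv by (simp add: x_def y_def algebra_simps)
  have "n + v = k * q + (n + v) mod q" by (simp add: k_def)
  moreover have "0 \<le> (n + v) mod q" "(n + v) mod q < q" using * by auto
  ultimately have yn: "y \<le> n" "n < y + q" by (auto simp: y_def)
  hence y1: "1 \<le> y" using qn by linarith
  have py: "0 \<le> p * y" "p * y \<le> (q - 1) * y" using * pq y1 by (auto intro: mult_right_mono)
  hence "q * x \<ge> 1" using xy by linarith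
  hence x0: "0 \<le> x" using * by (metis mult_pos_neg not_le not_one_le_zero order_trans
      zero_less_one_class.zero_le_one less_le_trans int_one_le_iff_zero_less not_less_iff_gr_or_eq)
  have "q * x \<le> q * y" using xy py y1 by (simp add: algebra_simps)
  hence xley: "x \<le> y" using * by simp
  have cxy: "coprime x y"
  proof (rule coprimeI)
    fix c assume "c dvd x" "c dvd y"
    hence "c dvd q * x - p * y" by (intro dvd_diff) auto
    thus "is_unit c" using xy by simp
  qed
  have mem: "(x, y) \<in> farey n" using x0 xley y1 yn cxy by (auto simp: farey_def)
  have "p * y < x * q" using xy by (simp add: mult.commute)
  hence ge: "\<not> (x * q' < p' * y)"
    using no mem * y1 by (fastforce simp: frac_less_iff)
  have id: "y * (p' * q - p * q') + q * (x * q' - p' * y) = q' * (q * x - p * y)"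
    by (simp add: algebra_simps)
  have "x * q' = p' * y"
  proof (rule ccontr)
    assume "x * q' \<noteq> p' * y"
    hence "x * q' - p' * y \<ge> 1" using ge by linarith
    moreover have "p' * q - p * q' \<ge> 1" using D by linarith
    ultimately have "y * 1 + q * 1 \<le> y * (p' * q - p * q') + q * (x * q' - p' * y)"
      using * y1 by (intro add_mono mult_left_mono) auto
    hence "y + q \<le> q'" using id xy by simp
    thus False using yn qn by linarith
  qed
  hence eq: "y * (p' * q - p * q') = q'" using id xy by simp
  have "q' dvd p' * y" using \<open>x * q' = p' * y\<close> by (metis dvd_triv_right)
  hence "q' dvd y" using cop by (simp add: coprime_commute coprime_dvd_mult_right_iff)
  hence "q' \<le> y" using y1 by (simp add: zdvd_imp_le)
  moreover have "y dvd q'" using eq by (metis dvd_triv_left)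
  hence "y \<le> q'" using * by (simp add: zdvd_imp_le)
  ultimately have "y = q'" by simp
  thus "p' * q - p * q' = 1" using eq * by simp
qed


subsection \<open>Uniqueness\<close>

lemma question_mark_unique_rat:
  assumes f: "is_question_mark f" and g: "is_question_mark g"
    and "0 \<le> p" "p \<le> q" "1 \<le> (q::int)" "coprime p q"
  shows "f (of_int p / of_int q) = g (of_int p / of_int q)"
  using assms(3-)
proof (induction "nat q" arbitrary: p q rule: less_induct)
  case less
  show ?case
  proof (cases "q = 1")
    case True
    hence "p = 0 \<or> p = 1" using less.prems by auto
    thus ?thesis using f g True by (auto simp: is_question_mark_def)
  next
    case False
    hence q2: "q \<ge> 2" using less.prems by simp
    have p1: "1 \<le> p" using less.prems q2 by (cases "p = 0") auto
    have pq: "p < q" using less.prems q2 by (cases "p = q") auto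
    obtain u v where uv: "u * p + v * q = 1"
      using bezout_int[of p q] less.prems by (auto simp: coprime_iff_gcd_eq_1)
    define y where "y = u mod q"
    define x where "x = - v - (u div q) * p"
    have "u = u div q * q + y" by (simp add: y_def)
    hence "u * p = (u div q * q + y) * p" by simp
    hence xy: "p * y - q * x = 1" using uv by (simp add: x_def algebra_simps)
    have y0: "0 \<le> y" "y < q" using q2 by (auto simp: y_def)
    have "y \<noteq> 0"
    proof
      assume "y = 0"
      hence "q dvd 1" using xy by (metis dvd_triv_left dvd_minus_iff mult_zero_right diff_0)
      thus False using q2 by simp
    qed
    hence y1: "1 \<le> y" using y0 by simp
    have x0: "0 \<le> x"
    proof (rule ccontr)
      assume "\<not> 0 \<le> x"
      hence "q * x \<le> q * (-1)" using q2 by (intro mult_left_mono) auto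
      moreover have "0 \<le> p * y" using p1 y1 by simp
      ultimately show False using xy q2 by linarith
    qed
    have xlp: "x < p"
    proof (rule ccontr)
      assume "\<not> x < p"
      hence "q * x \<ge> q * p" using q2 by (intro mult_left_mono) auto
      moreover have "p * y \<le> p * q" using p1 y0 by (intro mult_left_mono) auto
      ultimately show False using xy by (simp add: mult.commute)
    qed
    have xy'': "x < y"
    proof (rule ccontr)
      assume "\<not> x < y"
      hence "q * x \<ge> q * y" using q2 by (intro mult_left_mono) auto
      moreover have "p * y \<le> q * y" using pq y1 by (intro mult_right_mono) auto
      ultimately show False using xy by linarith
    qed
    hence xy': "x \<le> y" by simp
    have det: "(p - x) * y - x * (q - y) = 1" using xy by (simp add: algebra_simps)
    have le: "p - x \<le> q - y"
    proof (rule ccontr)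
      assume a: "\<not> p - x \<le> q - y"
      have "p - x - (q - y) \<ge> 1" using a by linarith
      hence "y * 1 + (q - y) * 1 \<le> y * (p - x - (q - y)) + (q - y) * (y - x)"
        using y0 xy'' by (intro add_mono mult_left_mono) auto
      also have "\<dots> = (p - x) * y - x * (q - y)" by (simp add: algebra_simps)
      also have "\<dots> = 1" by (rule det)
      finally show False using q2 by simp
    qed
    have con: "farey_consecutive x y (p - x) (q - y)"
      using x0 xy' y1 xlp le y0 det by (intro det_one_imp_farey_consecutive) auto
    have cop: "coprime x y" "coprime (p - x) (q - y)"
      using con by (auto simp: farey_consecutive_def farey_def)
    have 1: "f (of_int x / of_int y) = g (of_int x / of_int y)"
      using y0 y1 x0 xy' cop by (intro less.hyps) auto
    have 2: "f (of_int (p - x) / of_int (q - y)) = g (of_int (p - x) / of_int (q - y))"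
      using y0 y1 xlp le cop by (intro less.hyps) auto
    have *: "h (of_int p / of_int q) = (h (of_int x / of_int y) +
              h (of_int (p - x) / of_int (q - y))) / 2" if "is_question_mark h" for h
    proof -
      have "h (of_int (x + (p - x)) / of_int (y + (q - y))) =
              (h (of_int x / of_int y) + h (of_int (p - x) / of_int (q - y))) / 2"
        using that con unfolding is_question_mark_def by blast
      thus ?thesis by simp
    qed
    show ?thesis using *[OF f] *[OF g] 1 2 by simp
  qed
qed

lemma question_mark_unique:
  assumes f: "is_question_mark f" and g: "is_question_mark g"
  shows "f = g"
proof -
  have fE: "f \<in> extensional {0..1}" and gE: "g \<in> extensional {0..1}"
    using f g by (simp_all add: is_question_mark_def PiE_def)
  have cont: "continuous_on {0..1} (\<lambda>x. f x - g x)"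
    using f g by (auto simp: is_question_mark_def intro!: continuous_intros)
  have rat: "f z - g z = 0" if "z \<in> \<rat>" "z \<in> {0..1}" for z
  proof -
    obtain a b :: int where ab: "b > 0" "coprime a b" "z = of_int a / of_int b"
      using \<open>z \<in> \<rat>\<close> by (rule Rats_cases')
    have "0 \<le> a" "a \<le> b" using that ab by (auto simp: divide_simps)
    thus ?thesis using question_mark_unique_rat[OF f g, of a b] ab by simp
  qed
  have eq: "f x = g x" if x: "x \<in> {0..1}" for x
  proof (rule ccontr)
    assume "f x \<noteq> g x"
    hence "\<bar>f x - g x\<bar> > 0" by simp
    then obtain d where d: "d > 0"
      and dd: "\<And>z. z \<in> {0..1} \<Longrightarrow> dist z x < d \<Longrightarrow> dist (f z - g z) (f x - g x) < \<bar>f x - g x\<bar>"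
      using cont x unfolding continuous_on_iff by blast
    have "max 0 (x - d) < min 1 (x + d)" using x d by auto
    then obtain z where z: "z \<in> \<rat>" "max 0 (x - d) < z" "z < min 1 (x + d)"
      using Rats_dense_in_real by blast
    hence "z \<in> {0..1}" "dist z x < d" by (auto simp: dist_real_def)
    thus False using dd[of z] rat[of z] z by (simp add: dist_real_def)
  qed
  show ?thesis using fE gE eq by (rule extensionalityI)
qed


subsection \<open>Existence\<close>

text \<open>
  The question mark function is the fixed point of the following operator, which contracts
  the supremum norm by the factor \<open>1/2\<close>.
\<close>

definition qm_step :: "(real \<Rightarrow> real) \<Rightarrow> real \<Rightarrow> real" where
  "qm_step f x = (if x \<le> 1/2 then f (x / (1 - x)) / 2 else 1/2 + f (2 - 1 / x) / 2)"

definition qm_good :: "(real \<Rightarrow> real) \<Rightarrow> bool" where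
  "qm_good f \<longleftrightarrow> continuous_on {0..1} f \<and> mono_on {0..1} f \<and> f 0 = 0 \<and> f 1 = 1"

lemma qm_good_range: "qm_good f \<Longrightarrow> x \<in> {0..1} \<Longrightarrow> f x \<in> {0..1}"
  unfolding qm_good_def mono_on_def by (metis atLeastAtMost_iff order_refl zero_le_one)

lemma qm_left: "x \<in> {0..1/2} \<Longrightarrow> x / (1 - x) \<in> {0..1::real}"
  by (auto simp: divide_simps)

lemma qm_right: "x \<in> {1/2..1} \<Longrightarrow> 2 - 1 / x \<in> {0..1::real}"
  by (auto simp: divide_simps)

lemma qm_good_step:
  assumes "qm_good f" shows "qm_good (qm_step f)"
proof -
  have c: "continuous_on {0..1} f" and m: "mono_on {0..1} f" and f0: "f 0 = 0" and f1: "f 1 = 1"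
    using assms by (auto simp: qm_good_def)
  have cL: "continuous_on {0..1/2} (\<lambda>x::real. f (x / (1 - x)) / 2)"
    by (intro continuous_intros continuous_on_compose2[OF c]) (use qm_left in auto)
  have cR: "continuous_on {1/2..1} (\<lambda>x::real. 1/2 + f (2 - 1 / x) / 2)"
    by (intro continuous_intros continuous_on_compose2[OF c]) (use qm_right in auto)
  have "continuous_on {0..1} (qm_step f)"
    unfolding qm_step_def
  proof (rule continuous_on_cases_1)
    show "continuous_on {t \<in> {0..1}. t \<le> 1/2} (\<lambda>x. f (x / (1 - x)) / 2)"
      by (rule continuous_on_subset[OF cL]) auto
    show "continuous_on {t \<in> {0..1}. 1/2 \<le> t} (\<lambda>x. 1/2 + f (2 - 1 / x) / 2)"
      by (rule continuous_on_subset[OF cR]) auto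
  qed (simp add: f0 f1)
  moreover have "mono_on {0..1} (qm_step f)"
  proof (rule mono_onI)
    fix x y :: real assume xy: "x \<in> {0..1}" "y \<in> {0..1}" "x \<le> y"
    consider "y \<le> 1/2" | "x > 1/2" | "x \<le> 1/2" "y > 1/2" by linarith
    thus "qm_step f x \<le> qm_step f y"
    proof cases
      case 1
      have "x / (1 - x) \<le> y / (1 - y)" using 1 xy by (intro frac_le) auto
      hence "f (x / (1 - x)) \<le> f (y / (1 - y))"
        using m qm_left[of x] qm_left[of y] 1 xy by (auto simp: mono_on_def)
      thus ?thesis using 1 xy by (simp add: qm_step_def)
    next
      case 2
      have "2 - 1 / x \<le> 2 - 1 / y" using 2 xy by (simp add: frac_le)
      hence "f (2 - 1 / x) \<le> f (2 - 1 / y)"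
        using m qm_right[of x] qm_right[of y] 2 xy by (auto simp: mono_on_def)
      thus ?thesis using 2 xy by (simp add: qm_step_def)
    next
      case 3
      have "f (x / (1 - x)) \<le> 1" "f (2 - 1 / y) \<ge> 0"
        using qm_good_range[OF assms qm_left[of x]] qm_good_range[OF assms qm_right[of y]] 3 xy
        by auto
      thus ?thesis using 3 xy by (simp add: qm_step_def)
    qed
  qed
  ultimately show ?thesis using f0 f1 by (simp add: qm_good_def qm_step_def)
qed

definition qm_iter :: "nat \<Rightarrow> real \<Rightarrow> real" where
  "qm_iter n = (qm_step ^^ n) (\<lambda>x. x)"

lemma qm_iter_Suc: "qm_iter (Suc n) = qm_step (qm_iter n)"
  by (simp add: qm_iter_def)

lemma qm_good_iter: "qm_good (qm_iter n)"
proof (induction n)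
  case 0
  show ?case by (simp add: qm_iter_def qm_good_def mono_on_def)
qed (simp add: qm_iter_Suc qm_good_step)

lemma qm_iter_diff: "x \<in> {0..1} \<Longrightarrow> \<bar>qm_iter (Suc n) x - qm_iter n x\<bar> \<le> (1/2)^n"
proof (induction n arbitrary: x)
  case 0
  thus ?case using qm_good_range[OF qm_good_iter[of 0] 0] qm_good_range[OF qm_good_iter[of 1] 0]
    by (auto simp: abs_le_iff)
next
  case (Suc n)
  show ?case
  proof (cases "x \<le> 1/2")
    case True
    have "\<bar>qm_iter (Suc n) (x / (1 - x)) - qm_iter n (x / (1 - x))\<bar> \<le> (1/2)^n"
      using True Suc.prems by (intro Suc.IH qm_left) auto
    thus ?thesis using True
      by (simp add: qm_iter_Suc[of "Suc n"] qm_iter_Suc[of n] qm_step_def[of _ x] abs_if split: if_splits)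
  next
    case False
    have "\<bar>qm_iter (Suc n) (2 - 1 / x) - qm_iter n (2 - 1 / x)\<bar> \<le> (1/2)^n"
      using False Suc.prems by (intro Suc.IH qm_right) auto
    thus ?thesis using False
      by (simp add: qm_iter_Suc[of "Suc n"] qm_iter_Suc[of n] qm_step_def[of _ x] abs_if split: if_splits)
  qed
qed

lemma qm_fixpoint_exists: "\<exists>F. qm_good F \<and> (\<forall>x\<in>{0..1}. F x = qm_step F x)"
proof -
  define h where "h = (\<lambda>i x. qm_iter (Suc i) x - qm_iter i x)"
  define F where "F = (\<lambda>x. x + suminf (\<lambda>i. h i x))"
  have sums: "(\<Sum>i<n. h i x) = qm_iter n x - x" for n x
    by (induction n) (simp_all add: h_def qm_iter_def)
  have "uniform_limit {0..1} (\<lambda>n x. \<Sum>i<n. h i x) (\<lambda>x. suminf (\<lambda>i. h i x)) sequentially"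
    by (rule Weierstrass_m_test[where M = "\<lambda>n. (1/2)^n"])
       (use qm_iter_diff in \<open>auto simp: h_def summable_geometric_iff\<close>)
  hence "uniform_limit {0..1} (\<lambda>n x. x + (\<Sum>i<n. h i x)) F sequentially"
    unfolding F_def by (intro uniform_limit_intros)
  hence ul: "uniform_limit {0..1} qm_iter F sequentially" by (simp add: sums)
  have lim: "(\<lambda>n. qm_iter n x) \<longlonglongrightarrow> F x" if "x \<in> {0..1}" for x
    using tendsto_uniform_limitI[OF ul that] .
  have "continuous_on {0..1} F"
    by (rule uniform_limit_theorem[OF _ ul]) (use qm_good_iter in \<open>auto simp: qm_good_def\<close>)
  moreover have "mono_on {0..1} F"
  proof (rule mono_onI)
    fix x y :: real assume xy: "x \<in> {0..1}" "y \<in> {0..1}" "x \<le> y"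
    show "F x \<le> F y"
      by (rule LIMSEQ_le[OF lim lim])
         (use xy qm_good_iter in \<open>auto simp: qm_good_def mono_on_def\<close>)
  qed
  moreover have "F 0 = 0"
    by (rule LIMSEQ_unique[OF lim]) (use qm_good_iter in \<open>auto simp: qm_good_def\<close>)
  moreover have "F 1 = 1"
    by (rule LIMSEQ_unique[OF lim]) (use qm_good_iter in \<open>auto simp: qm_good_def\<close>)
  moreover have "F x = qm_step F x" if x: "x \<in> {0..1}" for x
  proof (rule LIMSEQ_unique)
    show "(\<lambda>n. qm_iter (Suc n) x) \<longlonglongrightarrow> F x"
      using lim[OF x] by (rule LIMSEQ_Suc)
    show "(\<lambda>n. qm_iter (Suc n) x) \<longlonglongrightarrow> qm_step F x"
      using x qm_left[of x] qm_right[of x]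
      by (auto simp: qm_iter_Suc qm_step_def intro!: tendsto_intros lim)
  qed
  ultimately show ?thesis by (auto simp: qm_good_def)
qed

lemma qm_fixpoint_mediant:
  fixes p q p' q' :: int
  assumes good: "qm_good F" and fp: "\<And>x. x \<in> {0..1} \<Longrightarrow> F x = qm_step F x"
    and "0 \<le> p" "p \<le> q" "1 \<le> q" "0 \<le> p'" "p' \<le> q'" "1 \<le> q'" "p' * q - p * q' = 1"
  shows "F (of_int (p + p') / of_int (q + q')) =
          (F (of_int p / of_int q) + F (of_int p' / of_int q')) / 2"
  using assms(3-)
proof (induction "nat (q + q')" arbitrary: p q p' q' rule: less_induct)
  case less
  have f0: "F 0 = 0" and f1: "F 1 = 1" using good by (auto simp: qm_good_def)
  have L: "F (of_int a / of_int b) = F (of_int a / of_int (b - a)) / 2"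
    if "0 \<le> a" "2 * a \<le> b" "1 \<le> b" for a b :: int
  proof -
    define z where "z = real_of_int a / of_int b"
    have 1: "z \<le> 1/2" and 2: "z \<in> {0..1}"
      using that by (auto simp: z_def divide_simps)
    have 3: "z / (1 - z) = of_int a / of_int (b - a)"
      using that by (simp add: z_def divide_simps)
    have "F z = F (z / (1 - z)) / 2" using fp[OF 2] 1 by (simp add: qm_step_def)
    thus ?thesis unfolding 3 by (simp add: z_def)
  qed
  have R: "F (of_int a / of_int b) = 1/2 + F (of_int (2 * a - b) / of_int a) / 2"
    if "a \<le> b" "b \<le> 2 * a" "1 \<le> b" for a b :: int
  proof (cases "2 * a = b")
    case True
    have "F (of_int a / of_int b) = F (of_int a / of_int (b - a)) / 2"
      using that True by (intro L) auto
    moreover have "b - a = a" "a \<noteq> 0" "2 * a - b = 0" using True that by auto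
    ultimately show ?thesis using f0 f1 by simp
  next
    case False
    hence "2 * a > b" using that by simp
    hence "\<not> real_of_int a / of_int b \<le> 1/2" using that by (simp add: divide_simps)
    moreover have "2 - 1 / (real_of_int a / of_int b) = of_int (2 * a - b) / of_int a"
      using that by (simp add: divide_simps)
    moreover have "real_of_int a / of_int b \<in> {0..1}" using that by (auto simp: divide_simps)
    ultimately show ?thesis using fp by (simp add: qm_step_def)
  qed
  have p'1: "1 \<le> p'"
  proof (rule ccontr)
    assume "\<not> 1 \<le> p'"
    hence "p' = 0" using less.prems by simp
    hence "p * q' = -1" using less.prems by simp
    moreover have "0 \<le> p * q'" using less.prems by (intro mult_nonneg_nonneg) auto
    ultimately show False by linarith
  qed
  have pq: "p < q"
  proof (rule ccontr)
    assume "\<not> p < q"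
    hence "p = q" using less.prems by simp
    hence "q * (p' - q') = 1" using less.prems by (simp add: algebra_simps)
    moreover have "q * (p' - q') \<le> 0" using less.prems by (intro mult_nonneg_nonpos) auto
    ultimately show False by simp
  qed
  consider "2 * p' \<le> q'" | "q \<le> 2 * p" | "2 * p < q" "q' < 2 * p'" by linarith
  thus ?case
  proof cases
    case 1
    have pL: "2 * p \<le> q"
    proof (rule ccontr)
      assume "\<not> 2 * p \<le> q"
      hence "q * q' \<le> 2 * p * q'" using less.prems by (intro mult_right_mono) auto
      moreover have "2 * p' * q \<le> q' * q" using 1 less.prems by (intro mult_right_mono) auto
      moreover have "2 * p' * q - 2 * p * q' = 2" using less.prems by (simp add: algebra_simps)
      ultimately show False by (simp add: mult.commute)
    qed
    have IH: "F (of_int (p + p') / of_int ((q - p) + (q' - p'))) =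
          (F (of_int p / of_int (q - p)) + F (of_int p' / of_int (q' - p'))) / 2"
      using less.prems p'1 1 pL pq by (intro less.hyps) (auto simp: algebra_simps)
    have e: "(q - p) + (q' - p') = (q + q') - (p + p')" by simp
    have "F (of_int (p + p') / of_int (q + q')) = F (of_int (p + p') / of_int ((q + q') - (p + p'))) / 2"
      using less.prems pL 1 by (intro L) auto
    thus ?thesis using IH L[of p q] L[of p' q'] less.prems pL 1 unfolding e by simp
  next
    case 2
    have pR: "q' \<le> 2 * p'"
    proof (rule ccontr)
      assume "\<not> q' \<le> 2 * p'"
      hence "2 * p' * q \<le> q' * q" using less.prems by (intro mult_right_mono) auto
      moreover have "q * q' \<le> 2 * p * q'" using 2 less.prems by (intro mult_right_mono) auto
      moreover have "2 * p' * q - 2 * p * q' = 2" using less.prems by (simp add: algebra_simps)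
      ultimately show False by (simp add: mult.commute)
    qed
    have IH: "F (of_int ((2 * p - q) + (2 * p' - q')) / of_int (p + p')) =
          (F (of_int (2 * p - q) / of_int p) + F (of_int (2 * p' - q') / of_int p')) / 2"
      using less.prems p'1 2 pR pq by (intro less.hyps) (auto simp: algebra_simps)
    have e: "(2 * p - q) + (2 * p' - q') = 2 * (p + p') - (q + q')" by simp
    have "F (of_int (p + p') / of_int (q + q')) =
            1/2 + F (of_int (2 * (p + p') - (q + q')) / of_int (p + p')) / 2"
      using less.prems pR 2 by (intro R) auto
    thus ?thesis using IH R[of p q] R[of p' q'] less.prems pR 2 unfolding e by (simp add: field_simps)
  next
    case 3
    have "(q' + 1) * q \<le> (2 * p') * q" "(2 * p) * q' \<le> (q - 1) * q'"
      using 3 less.prems by (auto intro!: mult_right_mono)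
    moreover have "2 * p' * q - 2 * p * q' = 2" using less.prems by (simp add: algebra_simps)
    ultimately have "q + q' \<le> 2" by (simp add: algebra_simps)
    hence qq: "q = 1" "q' = 1" using less.prems by auto
    hence pp: "p = 0" "p' = 1" using pq p'1 less.prems by auto
    show ?thesis using L[of 1 2] qq pp f0 f1 by simp
  qed
qed

theorem ex1_question_mark: "\<exists>!f. is_question_mark f"
proof -
  obtain F where F: "qm_good F" "\<And>x. x \<in> {0..1} \<Longrightarrow> F x = qm_step F x"
    using qm_fixpoint_exists by blast
  define G where "G = restrict F {0..1}"
  have G: "G x = F x" if "x \<in> {0..1}" for x using that by (simp add: G_def)
  have "is_question_mark G"
    unfolding is_question_mark_def
  proof (intro conjI allI impI)
    show "G \<in> {0..1} \<rightarrow>\<^sub>E {0..1}" unfolding G_def using qm_good_range[OF F(1)] by auto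
    show "continuous_on {0..1} G" 
      using F(1) by (subst continuous_on_cong[OF refl G]) (auto simp: qm_good_def)
    show "mono_on {0..1} G" using F(1) G by (auto simp: qm_good_def mono_on_def)
    show "G 0 = 0" "G 1 = 1" using F(1) G by (auto simp: qm_good_def)
    fix p q p' q' :: int assume "farey_consecutive p q p' q'"
    note D = farey_consecutiveD[OF this]
    have m: "F (of_int (p + p') / of_int (q + q')) =
          (F (of_int p / of_int q) + F (of_int p' / of_int q')) / 2"
      by (rule qm_fixpoint_mediant[OF F D])
    have "real_of_int a / of_int b \<in> {0..1}" if "0 \<le> a" "a \<le> b" "1 \<le> b" for a b :: int
      using that by (auto simp: divide_simps)
    from this[of "p + p'" "q + q'"] this[of p q] this[of p' q']
    show "G (of_int (p + p') / of_int (q + q')) =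
          (G (of_int p / of_int q) + G (of_int p' / of_int q')) / 2"
      using m D by (simp add: G)
  qed
  thus ?thesis using question_mark_unique by blast
qed

lemma is_question_mark_question_mark: "is_question_mark question_mark"
  unfolding question_mark_def by (rule theI'[OF ex1_question_mark])

end

theory Submission
  imports Defs
begin

text \<open>
  Let \<open>u\<^sub>k\<close> be the orbit of \<open>x\<close> under the Gauss map and follow a nearby point \<open>y\<close> along the
  branches chosen by \<open>x\<close>: \<open>v\<^sub>0 = y\<close>, \<open>v\<^sub>k\<^sub>+\<^sub>1 = 1 / v\<^sub>k - a\<^sub>k\<^sub>+\<^sub>1\<close>. With the denominators \<open>q\<^sub>t\<close>
  of the convergents of \<open>x\<close>, the distance of \<open>x\<close> and \<open>y\<close> is at most \<open>1 / q\<^sub>t\<^sup>2\<close> as long as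
  \<open>v\<^sub>0, \<dots>, v\<^sub>t\<close> stay in the unit interval, whereas the branch with partial quotient \<open>a\<close> scales
  increments of the question mark function by exactly \<open>2\<close> to the power \<open>-a\<close>. At the first
  \<open>t\<close> with \<open>v\<^sub>t\<^sub>+\<^sub>1\<close> outside the unit interval, \<open>u\<^sub>t\<close> and \<open>v\<^sub>t\<close> are separated enough for their
  values to differ by at least \<open>1 / 512\<close>.
  So everything rests on \<open>q\<^sub>t\<^sup>2\<close> growing faster than \<open>2\<close> to the power \<open>a\<^sub>1 + \<dots> + a\<^sub>t\<close>; for
  partial quotients at most 4 this holds because the quadratic form \<open>3 q\<^sub>t\<^sub>+\<^sub>1\<^sup>2 + 2 q\<^sub>t\<^sup>2\<close> gains
  in every step at least the factor \<open>51 / 50\<close> over the power of two.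
\<close>

section \<open>Functional equations of the question mark function\<close>

text \<open>The defining conditions do not mention \<open>qm_step\<close>. By uniqueness
  \<open>question_mark\<close> agrees on the unit interval with a fixed point of
  \<open>qm_step\<close>, which carries the equation over.\<close>

lemma question_mark_step:
  assumes "x \<in> {0..1}"
  shows "question_mark x = qm_step question_mark x"
proof -
  obtain F where F: "qm_good F" "\<And>x. x \<in> {0..1} \<Longrightarrow> F x = qm_step F x"
    using qm_fixpoint_exists by blast
  define G where "G = restrict F {0..1}"
  have G: "G x = F x" if "x \<in> {0..1}" for x using that by (simp add: G_def)
  have "is_question_mark G"
    unfolding is_question_mark_def
  proof (intro conjI allI impI)
    show "G \<in> {0..1} \<rightarrow>\<^sub>E {0..1}" unfolding G_def using qm_good_range[OF F(1)] by auto
    show "continuous_on {0..1} G"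
      using F(1) by (subst continuous_on_cong[OF refl G]) (auto simp: qm_good_def)
    show "mono_on {0..1} G" "G 0 = 0" "G 1 = 1"
      using F(1) G by (auto simp: qm_good_def mono_on_def)
    fix p q p' q' :: int assume "farey_consecutive p q p' q'"
    note D = farey_consecutiveD[OF this]
    have "real_of_int a / of_int b \<in> {0..1}" if "0 \<le> a" "a \<le> b" "1 \<le> b" for a b :: int
      using that by (auto simp: divide_simps)
    from this[of "p + p'" "q + q'"] this[of p q] this[of p' q']
    show "G (of_int (p + p') / of_int (q + q')) =
          (G (of_int p / of_int q) + G (of_int p' / of_int q')) / 2"
      using qm_fixpoint_mediant[OF F D] D by (simp add: G)
  qed
  hence "question_mark = G"
    using question_mark_unique is_question_mark_question_mark by blast
  hence eq: "question_mark z = F z" if "z \<in> {0..1}" for z using G that by simp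
  show ?thesis
    using F(2)[OF assms] assms qm_left[of x] qm_right[of x]
    by (auto simp: qm_step_def eq)
qed

lemma question_mark_simps [simp]: "question_mark 0 = 0" "question_mark 1 = 1"
  using is_question_mark_question_mark by (auto simp: is_question_mark_def)

lemma question_mark_mono:
  "0 \<le> x \<Longrightarrow> x \<le> y \<Longrightarrow> y \<le> 1 \<Longrightarrow> question_mark x \<le> question_mark y"
  using is_question_mark_question_mark by (auto simp: is_question_mark_def mono_on_def)

lemma question_mark_range:
  "0 \<le> x \<Longrightarrow> x \<le> 1 \<Longrightarrow> 0 \<le> question_mark x \<and> question_mark x \<le> 1"
  using question_mark_mono[of 0 x] question_mark_mono[of x 1] by simp

text \<open>The defect of the symmetry is invariant under z -> 1 - z and, for z \<le> 1/2, is half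
  the defect at z / (1 - z). Being at most 1 in absolute value, it is at most (1/2)^n for every
  n.\<close>

lemma question_mark_reflect:
  assumes "0 \<le> x" "x \<le> 1"
  shows "question_mark (1 - x) = 1 - question_mark x"
proof -
  have half: "question_mark z + question_mark (1 - z) - 1 =
      (question_mark (z / (1 - z)) + question_mark (1 - z / (1 - z)) - 1) / 2"
    if z: "0 \<le> z" "z \<le> 1/2" for z
  proof (cases "z = 1/2")
    case True
    show ?thesis unfolding True using question_mark_step[of "1/2"] by (simp add: qm_step_def)
  next
    case False
    have eq: "2 - 1 / (1 - z) = 1 - z / (1 - z)" using z by (simp add: field_simps)
    have "question_mark (1 - z) = 1/2 + question_mark (2 - 1 / (1 - z)) / 2"
      using z False question_mark_step[of "1 - z"] by (simp add: qm_step_def)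
    hence "question_mark (1 - z) = 1/2 + question_mark (1 - z / (1 - z)) / 2"
      unfolding eq .
    moreover have "question_mark z = question_mark (z / (1 - z)) / 2"
      using z question_mark_step[of z] by (simp add: qm_step_def)
    ultimately show ?thesis by simp
  qed
  have bound: "\<bar>question_mark z + question_mark (1 - z) - 1\<bar> \<le> (1/2)^n"
    if "0 \<le> z" "z \<le> 1" for z n
    using that
  proof (induction n arbitrary: z)
    case 0
    thus ?case using question_mark_range[of z] question_mark_range[of "1 - z"] by auto
  next
    case (Suc n)
    have left: "\<bar>question_mark w + question_mark (1 - w) - 1\<bar> \<le> (1/2)^Suc n"
      if "0 \<le> w" "w \<le> 1/2" for w
    proof -
      have "\<bar>question_mark (w / (1 - w)) + question_mark (1 - w / (1 - w)) - 1\<bar> \<le> (1/2)^n"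
        using qm_left[of w] that by (intro Suc.IH) auto
      thus ?thesis unfolding half[OF that] by simp
    qed
    show ?case
    proof (cases "z \<le> 1/2")
      case True
      thus ?thesis using left[of z] Suc.prems by simp
    next
      case False
      thus ?thesis using left[of "1 - z"] Suc.prems by (simp add: add.commute)
    qed
  qed
  define e where "e = \<bar>question_mark x + question_mark (1 - x) - 1\<bar>"
  have "e = 0"
  proof (rule ccontr)
    assume "e \<noteq> 0"
    hence "0 < e" by (simp add: e_def)
    then obtain n where "(1/2)^n < e" using real_arch_pow_inv[of e "1/2"] by auto
    thus False using bound[OF assms, of n] by (simp add: e_def)
  qed
  thus ?thesis by (simp add: e_def)
qed

text \<open>The map z -> z / (1 - z) lowers \<open>a\<close> by one while the left branch of
  \<open>qm_step\<close> halves the value. At \<open>a = 1\<close> the right branch leads to 1 - u,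
  and reflection finishes.\<close>

lemma question_mark_branch:
  assumes "0 \<le> u" "u \<le> 1" "a \<ge> 1"
  shows "question_mark (1 / (real a + u)) = (2 - question_mark u) / 2 ^ a"
  using assms(3)
proof (induction a rule: nat_induct_at_least)
  case base
  show ?case
  proof (cases "u = 1")
    case True
    thus ?thesis using question_mark_step[of "1/2"] by (simp add: qm_step_def)
  next
    case False
    hence "\<not> 1 / (1 + u) \<le> 1/2" using assms by (simp add: field_simps)
    thus ?thesis
      using question_mark_step[of "1 / (1 + u)"] question_mark_reflect[of u] assms
      by (simp add: qm_step_def field_simps)
  qed
next
  case (Suc a)
  define z where "z = 1 / (real (Suc a) + u)"
  have z: "0 \<le> z" "z \<le> 1/2" "z / (1 - z) = 1 / (real a + u)"
    using assms Suc.hyps by (auto simp: z_def field_simps)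
  have "question_mark z = question_mark (1 / (real a + u)) / 2"
    using question_mark_step[of z] z by (simp add: qm_step_def)
  thus ?case using Suc.IH by (simp add: z_def)
qed

lemma question_mark_branch_diff:
  assumes "0 \<le> u" "u \<le> 1" "0 \<le> v" "v \<le> 1" "a \<ge> 1"
  shows "\<bar>question_mark u - question_mark v\<bar> =
    2 ^ a * \<bar>question_mark (1 / (real a + u)) - question_mark (1 / (real a + v))\<bar>"
proof -
  have "question_mark (1 / (real a + u)) - question_mark (1 / (real a + v)) =
      (question_mark v - question_mark u) / 2 ^ a"
    using assms by (simp add: question_mark_branch diff_divide_distrib)
  thus ?thesis by (simp add: abs_minus_commute)
qed

text \<open>The branch has end values 1 / 2^a and 2 / 2^a. Since 1/5 and 5/6 have values 1/16 and
  31/32, the value at 1 / (a + u) is at least (1/32) / 2^a away from both, and 2^a \<le> 16.\<close>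

lemma question_mark_separation:
  assumes u: "1/5 \<le> u" "u \<le> 5/6" and a: "1 \<le> a" "a \<le> 4" and w: "0 \<le> w" "w \<le> 1"
    and out: "w < 1 / (real a + 1) \<or> 1 / real a < w"
  shows "1 / 512 \<le> \<bar>question_mark (1 / (real a + u)) - question_mark w\<bar>"
proof -
  have "question_mark (1/5) = 1/16"
    using question_mark_branch[of 0 5] by simp
  hence lo: "1/16 \<le> question_mark u" using question_mark_mono[of "1/5" u] u by simp
  have "question_mark (5/6) = 31/32"
    using question_mark_branch[of "1/5" 1] question_mark_branch[of 0 5] by simp
  hence hi: "question_mark u \<le> 31/32" using question_mark_mono[of u "5/6"] u by simp
  have pa: "(2::real) ^ a \<le> 16" using power_increasing[of a 4 "2::real"] a by simp
  have gap: "1 / 512 \<le> d / 2 ^ a" if "1/32 \<le> d" for d :: real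
  proof -
    have "1 / 512 = (1/32) / (16::real)" by simp
    also have "\<dots> \<le> d / 2 ^ a" using that pa by (intro frac_le) auto
    finally show ?thesis .
  qed
  have eq: "question_mark (1 / (real a + u)) = (2 - question_mark u) / 2 ^ a"
    using question_mark_branch[of u a] u a by simp
  from out show ?thesis
  proof
    assume "w < 1 / (real a + 1)"
    hence "question_mark w \<le> question_mark (1 / (real a + 1))"
      using w a by (intro question_mark_mono) auto
    also have "\<dots> = 1 / 2 ^ a" using question_mark_branch[of 1 a] a by simp
    finally have "(1 - question_mark u) / 2 ^ a
        \<le> question_mark (1 / (real a + u)) - question_mark w"
      by (simp add: eq diff_divide_distrib)
    moreover have "1 / 512 \<le> (1 - question_mark u) / 2 ^ a" using hi by (intro gap) simp
    ultimately show ?thesis by linarith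
  next
    assume "1 / real a < w"
    hence "question_mark (1 / real a) \<le> question_mark w"
      using w a by (intro question_mark_mono) auto
    moreover have "question_mark (1 / real a) = 2 / 2 ^ a"
      using question_mark_branch[of 0 a] a by simp
    ultimately have "question_mark u / 2 ^ a
        \<le> question_mark w - question_mark (1 / (real a + u))"
      by (simp add: eq diff_divide_distrib)
    moreover have "1 / 512 \<le> question_mark u / 2 ^ a" using lo by (intro gap) simp
    ultimately show ?thesis by linarith
  qed
qed

section \<open>Growth of the denominators of the convergents\<close>

text \<open>Here and below \<open>a k\<close> stands for the partial quotient with index \<open>k + 1\<close>.\<close>

fun cf_denom :: "(nat \<Rightarrow> nat) \<Rightarrow> nat \<Rightarrow> real" where
  "cf_denom a 0 = 1"
| "cf_denom a (Suc 0) = real (a 0)"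
| "cf_denom a (Suc (Suc n)) = real (a (Suc n)) * cf_denom a (Suc n) + cf_denom a n"

lemma cf_denom_mono:
  assumes "\<And>k. a k \<ge> 1"
  shows "1 \<le> cf_denom a n \<and> cf_denom a n \<le> cf_denom a (Suc n)"
proof (induction n)
  case 0
  show ?case using assms[of 0] by simp
next
  case (Suc n)
  have "1 * cf_denom a (Suc n) \<le> real (a (Suc n)) * cf_denom a (Suc n)"
    using assms[of "Suc n"] Suc by (intro mult_right_mono) auto
  thus ?case using Suc.IH unfolding cf_denom.simps by linarith
qed

lemma cf_denom_ratio:
  assumes "\<And>k. a k \<ge> 1" "\<And>k. a k \<le> 4"
  shows "cf_denom a (Suc n) \<le> 5 * cf_denom a n"
    and "6 * cf_denom a (Suc n) \<le> 5 * cf_denom a (Suc (Suc n))"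
proof -
  note mono = cf_denom_mono[of a, OF assms(1)]
  have le: "cf_denom a (Suc n) \<le> 5 * cf_denom a n" for n
  proof (cases n)
    case 0
    thus ?thesis using assms(2)[of 0] by simp
  next
    case (Suc m)
    have "real (a (Suc m)) * cf_denom a (Suc m) \<le> 4 * cf_denom a (Suc m)"
      using assms(2)[of "Suc m"] mono[of "Suc m"] by (intro mult_right_mono) auto
    thus ?thesis using mono[of m] unfolding Suc cf_denom.simps by linarith
  qed
  show "cf_denom a (Suc n) \<le> 5 * cf_denom a n" by (rule le)
  have "1 * cf_denom a (Suc n) \<le> real (a (Suc n)) * cf_denom a (Suc n)"
    using assms(1)[of "Suc n"] mono[of "Suc n"] by (intro mult_right_mono) auto
  thus "6 * cf_denom a (Suc n) \<le> 5 * cf_denom a (Suc (Suc n))" using le[of n] by simp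
qed

text \<open>
  The coefficients 3 and 2 are chosen to balance the critical periodic sequence 1, 4, 1, 4, \<dots>;
  the bounds on \<open>q / p\<close> matter, since the case \<open>a = 4\<close> fails at \<open>q = p\<close>.
\<close>

lemma quadratic_form_gain:
  fixes p q :: real
  assumes "1 \<le> a" "a \<le> (4::nat)" "0 < p" "6 * p \<le> 5 * q" "q \<le> 5 * p"
  shows "51/50 * 2 ^ a * (3 * q\<^sup>2 + 2 * p\<^sup>2) \<le> 3 * (real a * q + p)\<^sup>2 + 2 * q\<^sup>2"
proof -
  \<comment> \<open>For \<open>a = 1\<close> the difference of the two sides is concave in
    \<open>q / p\<close>; this product brings in both ends of the range of the ratio.\<close>
  have key: "0 \<le> (5 * p - q) * (5 * q - 6 * p)" using assms by (intro mult_nonneg_nonneg) auto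
  have pq: "0 \<le> (5 * q - 6 * p) * q" "0 \<le> (5 * q - 6 * p) * p" "0 \<le> (5 * p - q) * q" "0 \<le> (5 * p - q) * p"
    using assms by (auto intro!: mult_nonneg_nonneg)
  have "a = 1 \<or> a = 2 \<or> a = 3 \<or> a = 4" using assms by auto
  thus ?thesis
    using key pq by (elim disjE) (simp_all add: power2_eq_square algebra_simps)
qed

lemma cf_denom_growth:
  assumes a: "\<And>k. a k \<ge> 1" "\<And>k. a k \<le> 4"
  shows "(51/50) ^ n * 2 ^ (\<Sum>k<n. a k) \<le> 1500 * (cf_denom a n)\<^sup>2"
proof -
  define H where "H = (\<lambda>n. 3 * (cf_denom a (Suc n))\<^sup>2 + 2 * (cf_denom a n)\<^sup>2)"
  note mono = cf_denom_mono[of a, OF a(1)]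
  have H5: "5 \<le> H n" for n
  proof -
    have "1 \<le> (cf_denom a (Suc n))\<^sup>2" "1 \<le> (cf_denom a n)\<^sup>2"
      using mono[of n] by (auto simp: one_le_power)
    thus ?thesis by (simp add: H_def)
  qed
  have step: "51/50 * 2 ^ a (Suc (Suc n)) * H (Suc n) \<le> H (Suc (Suc n))" for n
    unfolding H_def
    using quadratic_form_gain[of "a (Suc (Suc n))" "cf_denom a (Suc n)" "cf_denom a (Suc (Suc n))"]
      a[of "Suc (Suc n)"] mono[of "Suc n"] cf_denom_ratio[of a, OF a, of "Suc n"] cf_denom_ratio[of a, OF a, of n]
    by simp
  have pow: "(2::real) ^ a k \<le> 16" for k using power_increasing[of "a k" 4 "2::real"] a by simp
  \<comment> \<open>The induction starts at \<open>H 1\<close>, since \<open>cf_denom a 1\<close>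
    may equal \<open>cf_denom a 0\<close> and the ratio bound 6/5 holds only later. The factor 300
    absorbs the first two powers of two, at most 256 together.\<close>
  have main: "(51/50) ^ Suc (Suc n) * 2 ^ (\<Sum>k<Suc (Suc n). a k) \<le> 300 * H (Suc n)" for n
  proof (induction n)
    case 0
    have "(2::real) ^ a 0 * 2 ^ a 1 \<le> 16 * 16" using pow by (intro mult_mono) auto
    thus ?case using H5[of 1] by (simp add: power_add power2_eq_square)
  next
    case (Suc n)
    have "(51/50) ^ Suc (Suc (Suc n)) * 2 ^ (\<Sum>k<Suc (Suc (Suc n)). a k) =
       (51/50 * 2 ^ a (Suc (Suc n))) * ((51/50) ^ Suc (Suc n) * (2::real) ^ (\<Sum>k<Suc (Suc n). a k))"
      by (simp add: power_add)
    also have "\<dots> \<le> (51/50 * 2 ^ a (Suc (Suc n))) * (300 * H (Suc n))"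
      using Suc.IH by (intro mult_left_mono) auto
    also have "\<dots> \<le> 300 * H (Suc (Suc n))" using step[of n] by (simp add: algebra_simps)
    finally show ?case .
  qed
  consider "n = 0" | "n = 1" | m where "n = Suc (Suc m)"
    by (metis One_nat_def not0_implies_Suc)
  thus ?thesis
  proof cases
    case 2
    have "1 \<le> (real (a 0))\<^sup>2" using a(1)[of 0] by (simp add: one_le_power)
    thus ?thesis using 2 pow[of 0] by simp
  next
    case (3 m)
    have "(cf_denom a (Suc m))\<^sup>2 \<le> (cf_denom a n)\<^sup>2"
      using mono[of "Suc m"] mono[of m] 3 by (intro power_mono) auto
    hence "H (Suc m) \<le> 5 * (cf_denom a n)\<^sup>2" using 3 by (simp add: H_def)
    thus ?thesis using main[of m] 3 by simp
  qed simp
qed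

section \<open>Two points following the same branches\<close>

text \<open>The product is the square root of the absolute derivative of the composed inverse
  branches at \<open>v (Suc t)\<close>. In the induction, 1 / v = a + v' reproduces the recurrence
  of \<open>cf_denom\<close>.\<close>

lemma orbit_prod:
  assumes "\<And>k. k \<le> t \<Longrightarrow> 0 < v k \<and> v k = 1 / (real (a k) + v (Suc k))"
  shows "(\<Prod>k<Suc t. v k) = 1 / (cf_denom a (Suc t) + v (Suc t) * cf_denom a t)"
  using assms
proof (induction t)
  case 0
  have "v 0 = 1 / (real (a 0) + v (Suc 0))" using 0[of 0] by simp
  thus ?case by simp
next
  case (Suc t)
  have v: "0 < v (Suc t)" "v (Suc t) = 1 / (real (a (Suc t)) + v (Suc (Suc t)))"
    using Suc.prems[of "Suc t"] by auto
  hence inv: "1 / v (Suc t) = real (a (Suc t)) + v (Suc (Suc t))" by simp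
  have "(\<Prod>k<Suc (Suc t). v k) = v (Suc t) / (cf_denom a (Suc t) + v (Suc t) * cf_denom a t)"
    using Suc.IH[OF Suc.prems] by simp
  also have "\<dots> = 1 / (1 / v (Suc t) * cf_denom a (Suc t) + cf_denom a t)"
    using v(1) by (simp add: field_simps)
  also have "\<dots> = 1 / (cf_denom a (Suc (Suc t)) + v (Suc (Suc t)) * cf_denom a (Suc t))"
    unfolding inv by (simp add: algebra_simps)
  finally show ?case .
qed

lemma orbit_prod_le:
  assumes a: "\<And>k. a k \<ge> 1" and v: "\<And>k. k < t \<Longrightarrow> v k = 1 / (real (a k) + v (Suc k))"
    and nonneg: "\<And>k. k \<le> t \<Longrightarrow> 0 \<le> v k"
  shows "0 \<le> (\<Prod>k<t. v k)" "(\<Prod>k<t. v k) \<le> 1 / cf_denom a t"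
proof -
  show "0 \<le> (\<Prod>k<t. v k)" using nonneg by (intro prod_nonneg) auto
  show "(\<Prod>k<t. v k) \<le> 1 / cf_denom a t"
  proof (cases t)
    case (Suc s)
    have pos: "0 < v k" if "k \<le> s" for k
    proof -
      have "0 < real (a k) + v (Suc k)" using a[of k] nonneg[of "Suc k"] that Suc by simp
      thus ?thesis using v[of k] that Suc by simp
    qed
    have "(\<Prod>k<t. v k) = 1 / (cf_denom a t + v t * cf_denom a s)"
      unfolding Suc
    proof (rule orbit_prod)
      fix k assume k: "k \<le> s"
      have "v k = 1 / (real (a k) + v (Suc k))" using k Suc by (intro v) simp
      thus "0 < v k \<and> v k = 1 / (real (a k) + v (Suc k))" using pos k by blast
    qed
    also have "\<dots> \<le> 1 / cf_denom a t"
    proof (rule divide_left_mono)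
      show "cf_denom a t \<le> cf_denom a t + v t * cf_denom a s"
        using nonneg[of t] cf_denom_mono[of a, OF a, of s] by simp
      thus "0 < (cf_denom a t + v t * cf_denom a s) * cf_denom a t"
        using cf_denom_mono[of a, OF a, of t] by (intro mult_pos_pos) auto
    qed simp
    finally show ?thesis .
  qed simp
qed

text \<open>One step gives u - v = u * v * (v' - u'), where u' and v' are the successors. So the
  initial distance is the final one times both orbit products, each at most
  \<open>1 / cf_denom a t\<close>.\<close>

lemma orbit_diff:
  fixes u v :: "nat \<Rightarrow> real"
  assumes a: "\<And>k. a k \<ge> 1"
    and u: "\<And>k. k < t \<Longrightarrow> u k = 1 / (real (a k) + u (Suc k))" "\<And>k. k \<le> t \<Longrightarrow> 0 \<le> u k \<and> u k \<le> 1"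
    and v: "\<And>k. k < t \<Longrightarrow> v k = 1 / (real (a k) + v (Suc k))" "\<And>k. k \<le> t \<Longrightarrow> 0 \<le> v k \<and> v k \<le> 1"
  shows "\<bar>u 0 - v 0\<bar> \<le> 1 / (cf_denom a t)\<^sup>2"
    and "\<bar>question_mark (u t) - question_mark (v t)\<bar> =
      2 ^ (\<Sum>k<t. a k) * \<bar>question_mark (u 0) - question_mark (v 0)\<bar>"
proof -
  have u0: "0 \<le> u k" and v0: "0 \<le> v k" if "k \<le> t" for k
    using u(2)[OF that] v(2)[OF that] by blast+
  have Pu: "0 \<le> (\<Prod>k<t. u k)" "(\<Prod>k<t. u k) \<le> 1 / cf_denom a t"
    by (rule orbit_prod_le[of a t u]; fact a u(1) u0)+
  have Pv: "0 \<le> (\<Prod>k<t. v k)" "(\<Prod>k<t. v k) \<le> 1 / cf_denom a t"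
    by (rule orbit_prod_le[of a t v]; fact a v(1) v0)+
  have c: "0 \<le> 1 / cf_denom a t" using cf_denom_mono[of a t, OF a] by simp
  have le1: "\<bar>u t - v t\<bar> \<le> 1" using u(2)[of t] v(2)[of t] by auto
  have "\<bar>u 0 - v 0\<bar> = (\<Prod>k<s. u k) * (\<Prod>k<s. v k) * \<bar>u s - v s\<bar>" if "s \<le> t" for s
    using that
  proof (induction s)
    case (Suc s)
    have pos: "0 < real (a s) + u (Suc s)" "0 < real (a s) + v (Suc s)"
      using a[of s] u0[of "Suc s"] v0[of "Suc s"] Suc.prems by auto
    have us: "u s = 1 / (real (a s) + u (Suc s))" and vs: "v s = 1 / (real (a s) + v (Suc s))"
      using u(1) v(1) Suc.prems by (meson Suc_le_lessD)+
    have "1 / (real (a s) + p) - 1 / (real (a s) + q) =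
        1 / (real (a s) + p) * (1 / (real (a s) + q)) * (q - p)"
      if "0 < real (a s) + p" "0 < real (a s) + q" for p q
      using that by (simp add: field_simps)
    hence "u s - v s = u s * v s * (v (Suc s) - u (Suc s))"
      using pos unfolding us vs by blast
    hence "\<bar>u s - v s\<bar> = u s * v s * \<bar>u (Suc s) - v (Suc s)\<bar>"
      using u0[of s] v0[of s] Suc.prems by (simp add: abs_mult abs_minus_commute)
    thus ?case using Suc.IH Suc.prems by simp
  qed simp
  hence "\<bar>u 0 - v 0\<bar> = (\<Prod>k<t. u k) * (\<Prod>k<t. v k) * \<bar>u t - v t\<bar>" by simp
  also have "\<dots> \<le> (1 / cf_denom a t) * (1 / cf_denom a t) * 1"
    using Pu Pv le1 c by (intro mult_mono mult_nonneg_nonneg) auto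
  finally show "\<bar>u 0 - v 0\<bar> \<le> 1 / (cf_denom a t)\<^sup>2" by (simp add: power2_eq_square)
  have "\<bar>question_mark (u s) - question_mark (v s)\<bar> =
      2 ^ (\<Sum>k<s. a k) * \<bar>question_mark (u 0) - question_mark (v 0)\<bar>" if "s \<le> t" for s
    using that
  proof (induction s)
    case (Suc s)
    have "\<bar>question_mark (u (Suc s)) - question_mark (v (Suc s))\<bar> =
        2 ^ a s * \<bar>question_mark (u s) - question_mark (v s)\<bar>"
      using question_mark_branch_diff[of "u (Suc s)" "v (Suc s)" "a s"]
        u(1)[of s] v(1)[of s] u(2)[of "Suc s"] v(2)[of "Suc s"] a[of s] Suc.prems by auto
    thus ?case using Suc.IH Suc.prems by (simp add: power_add)
  qed simp
  thus "\<bar>question_mark (u t) - question_mark (v t)\<bar> =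
      2 ^ (\<Sum>k<t. a k) * \<bar>question_mark (u 0) - question_mark (v 0)\<bar>" by blast
qed

text \<open>As 1 / 0 = 0, a value 0 is followed by \<open>- real (a k)\<close>, outside the unit
  interval for positive \<open>a k\<close>, and v = 1 / (a + v') holds without exception.\<close>

primrec follow :: "(nat \<Rightarrow> nat) \<Rightarrow> real \<Rightarrow> nat \<Rightarrow> real" where
  "follow a y 0 = y"
| "follow a y (Suc k) = 1 / follow a y k - real (a k)"

text \<open>The first exit from the unit interval comes after some step t \<ge> T, where separation
  applies. The constant is 1500 * 512, from the growth bound and the separation.\<close>

lemma difference_quotient_bound:
  assumes a: "\<And>k. a k \<ge> 1" "\<And>k. a k \<le> 4"
    and u: "\<And>k. u k = 1 / (real (a k) + u (Suc k))" "\<And>k. 0 < u k \<and> u k < 1"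
    and v: "\<And>k. k \<le> T \<Longrightarrow> 0 \<le> follow a y k \<and> follow a y k \<le> 1" and ne: "y \<noteq> u 0"
  shows "(51/50) ^ T / 768000 \<le> (question_mark y - question_mark (u 0)) / (y - u 0)"
proof -
  define good where "good = (\<lambda>t. \<forall>k\<le>t. 0 \<le> follow a y k \<and> follow a y k \<le> 1)"
  have dist: "\<bar>u 0 - y\<bar> \<le> 1 / (cf_denom a t)\<^sup>2"
    and scale: "\<bar>question_mark (u t) - question_mark (follow a y t)\<bar> =
      2 ^ (\<Sum>k<t. a k) * \<bar>question_mark (u 0) - question_mark y\<bar>" if "good t" for t
  proof -
    have u': "0 \<le> u k \<and> u k \<le> 1" for k using u(2)[of k] by simp
    have v': "follow a y k = 1 / (real (a k) + follow a y (Suc k))" for k by simp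
    have "\<And>k. k \<le> t \<Longrightarrow> 0 \<le> follow a y k \<and> follow a y k \<le> 1"
      using that by (simp add: good_def)
    note diff = orbit_diff[of a t u "follow a y", OF a(1) u(1) u' v' this]
    show "\<bar>u 0 - y\<bar> \<le> 1 / (cf_denom a t)\<^sup>2"
      "\<bar>question_mark (u t) - question_mark (follow a y t)\<bar> =
        2 ^ (\<Sum>k<t. a k) * \<bar>question_mark (u 0) - question_mark y\<bar>"
      using diff by (simp_all only: follow.simps(1))
  qed
  have denom_pos: "0 < (cf_denom a t)\<^sup>2" for t
    using cf_denom_mono[of a, OF a(1), of t] by simp
  \<comment> \<open>If \<open>y\<close> never left, its distance to \<open>u 0\<close> would be at
    most 1500 * (50/51)^t for every t, contradicting \<open>ne\<close>.\<close>
  have "\<exists>t. \<not> good t"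
  proof (rule ccontr)
    assume "\<nexists>t. \<not> good t"
    hence all: "good t" for t by blast
    obtain t where t: "1500 / \<bar>u 0 - y\<bar> < (51/50) ^ t"
      using real_arch_pow[of "51/50" "1500 / \<bar>u 0 - y\<bar>"] by auto
    have "(51/50) ^ t * 1 \<le> (51/50) ^ t * (2::real) ^ (\<Sum>k<t. a k)"
      by (intro mult_left_mono) auto
    also have "\<dots> \<le> 1500 * (cf_denom a t)\<^sup>2" by (rule cf_denom_growth[of a, OF a])
    also have "\<dots> \<le> 1500 / \<bar>u 0 - y\<bar>"
      using dist[OF all, of t] denom_pos[of t] ne by (simp add: field_simps)
    finally show False using t by simp
  qed
  moreover have "good T" using v by (auto simp: good_def)
  ultimately obtain t where t: "T \<le> t" "good t" "\<not> good (Suc t)"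
    using dec_induct[of T _ good] by (metis good_def le_trans nat_le_linear)
  define w where "w = follow a y t"
  have w: "0 \<le> w" "w \<le> 1" using t(2) by (auto simp: good_def w_def)
  have "\<not> (0 \<le> follow a y (Suc t) \<and> follow a y (Suc t) \<le> 1)"
    using t unfolding good_def by (metis le_Suc_eq)
  hence out: "w < 1 / (real (a t) + 1) \<or> 1 / real (a t) < w"
    using a(1)[of t] w by (cases "w = 0") (auto simp: w_def[symmetric] field_simps)
  have step: "1 / (real (a k) + u (Suc k)) = u k" for k by (rule u(1)[symmetric])
  \<comment> \<open>A quotient at most 4 and a tail below 1 give the lower end 1/5; fed back as a
    bound on the tail, it gives the upper end 5/6.\<close>
  have lower: "1/5 \<le> u k" for k
  proof -
    have "1 / 5 \<le> 1 / (real (a k) + u (Suc k))"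
      using a(1)[of k] a(2)[of k] u(2)[of "Suc k"] by (intro divide_left_mono) auto
    thus ?thesis unfolding step .
  qed
  have "1 / (real (a (Suc t)) + u (Suc (Suc t))) \<le> 1 / (6/5)"
    using a(1)[of "Suc t"] lower[of "Suc (Suc t)"] by (intro divide_left_mono) auto
  hence bounds: "1/5 \<le> u (Suc t)" "u (Suc t) \<le> 5/6"
    using lower step[of "Suc t"] by simp_all
  have "1 / 512 \<le> \<bar>question_mark (u t) - question_mark w\<bar>"
    using question_mark_separation[OF bounds a(1)[of t] a(2)[of t] w out] u(1)[of t] by simp
  hence num: "1 / 512 \<le> 2 ^ (\<Sum>k<t. a k) * \<bar>question_mark (u 0) - question_mark y\<bar>"
    using scale[OF t(2)] by (simp add: w_def)
  have y: "0 \<le> y" "y \<le> 1" using t(2) by (auto simp: good_def dest: spec[of _ 0])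
  have sign: "(question_mark y - question_mark (u 0)) / (y - u 0) =
      \<bar>question_mark (u 0) - question_mark y\<bar> / \<bar>u 0 - y\<bar>"
  proof (cases "y \<le> u 0")
    case True
    thus ?thesis using question_mark_mono[of y "u 0"] y u(2)[of 0] ne by (simp add: field_simps)
  next
    case False
    thus ?thesis using question_mark_mono[of "u 0" y] y u(2)[of 0] ne by (simp add: field_simps)
  qed
  define D where "D = \<bar>question_mark (u 0) - question_mark y\<bar>"
  have "(51/50) ^ T / 768000 \<le> (51/50) ^ t / (768000::real)"
    using t(1) by (intro divide_right_mono power_increasing) auto
  also have "\<dots> = (51/50) ^ t / 1500 * (1 / 512)" by simp
  also have "\<dots> \<le> (51/50) ^ t / 1500 * (2 ^ (\<Sum>k<t. a k) * D)"
    using num unfolding D_def by (intro mult_left_mono) auto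
  also have "\<dots> = D * ((51/50) ^ t * 2 ^ (\<Sum>k<t. a k) / 1500)" by simp
  also have "\<dots> \<le> D * (cf_denom a t)\<^sup>2"
    using cf_denom_growth[of a, OF a, of t] by (intro mult_left_mono) (auto simp: D_def)
  also have "\<dots> \<le> D * (1 / \<bar>u 0 - y\<bar>)"
    using dist[OF t(2)] denom_pos[of t] ne by (intro mult_left_mono) (auto simp: field_simps D_def)
  finally show ?thesis unfolding sign D_def by simp
qed

section \<open>The derivative\<close>

lemma gauss_map_orbit:
  assumes "x \<in> bounded_quotients n"
  defines "u \<equiv> \<lambda>k. (gauss_map ^^ k) x" and "a \<equiv> \<lambda>k. nat (partial_quotient x (Suc k))"
  shows "0 < u k \<and> u k < 1" "1 \<le> a k" "a k \<le> n" "u (Suc k) = 1 / u k - real (a k)"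
proof -
  \<comment> \<open>Irrationality belongs to the invariant because it keeps the orbit off 0.\<close>
  have inv: "0 < u k \<and> u k < 1 \<and> u k \<notin> \<rat>" for k
  proof (induction k)
    case 0
    show ?case using assms(1) by (simp add: u_def bounded_quotients_def)
  next
    case (Suc k)
    have eq: "u (Suc k) = 1 / u k - of_int \<lfloor>1 / u k\<rfloor>"
      by (simp add: u_def gauss_map_def frac_def)
    have "u (Suc k) \<notin> \<rat>"
    proof
      assume "u (Suc k) \<in> \<rat>"
      hence "1 / (u (Suc k) + of_int \<lfloor>1 / u k\<rfloor>) \<in> \<rat>" by (intro Rats_divide Rats_add) auto
      thus False using Suc by (simp add: eq)
    qed
    moreover have "0 \<le> u (Suc k)" "u (Suc k) < 1"
      by (auto simp: u_def gauss_map_def frac_lt_1)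
    moreover have "u (Suc k) \<noteq> 0" using \<open>u (Suc k) \<notin> \<rat>\<close> by auto
    ultimately show ?case by auto
  qed
  have pq: "partial_quotient x (Suc k) = \<lfloor>1 / u k\<rfloor>"
    by (simp add: partial_quotient_def u_def)
  have ge: "1 \<le> \<lfloor>1 / u k\<rfloor>" using inv[of k] by (simp add: le_floor_iff field_simps)
  have "partial_quotient x (Suc k) \<le> int n"
    using assms(1) by (auto simp: bounded_quotients_def)
  thus "a k \<le> n" by (simp add: a_def)
  show "0 < u k \<and> u k < 1" using inv by blast
  show "1 \<le> a k" using ge unfolding a_def pq by linarith
  show "u (Suc k) = 1 / u k - real (a k)"
  proof -
    have "real (a k) = of_int \<lfloor>1 / u k\<rfloor>" unfolding a_def pq using ge by (intro of_nat_nat) linarith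
    thus ?thesis by (simp add: u_def gauss_map_def frac_def)
  qed
qed

theorem theorem7:
  fixes x :: real
  assumes "x \<in> bounded_quotients 4"
  shows "filterlim (\<lambda>\<delta>. (question_mark (x + \<delta>) - question_mark x) / \<delta>) at_top (at 0)"
proof -
  define u where "u = (\<lambda>k. (gauss_map ^^ k) x)"
  define a where "a = (\<lambda>k. nat (partial_quotient x (Suc k)))"
  have orbit: "0 < u k \<and> u k < 1" "1 \<le> a k" "a k \<le> 4" "u (Suc k) = 1 / u k - real (a k)" for k
    unfolding u_def a_def by (fact gauss_map_orbit[OF assms])+
  have u: "u k = 1 / (real (a k) + u (Suc k))" for k using orbit(4)[of k] by simp
  have tendsto: "((\<lambda>\<delta>. follow a (x + \<delta>) k) \<longlongrightarrow> u k) (at 0)" for k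
  proof (induction k)
    case 0
    have "((\<lambda>\<delta>. x + \<delta>) \<longlongrightarrow> x + 0) (at 0)" by (intro tendsto_intros)
    thus ?case by (simp add: u_def)
  next
    case (Suc k)
    have "((\<lambda>\<delta>. 1 / follow a (x + \<delta>) k - real (a k)) \<longlongrightarrow> 1 / u k - real (a k)) (at 0)"
      using Suc orbit(1)[of k] by (intro tendsto_intros) auto
    thus ?case using orbit(4)[of k] by simp
  qed
  show ?thesis
    unfolding filterlim_at_top
  proof
    fix Z :: real
    obtain T where T: "768000 * Z < (51/50) ^ T" using real_arch_pow[of "51/50" "768000 * Z"] by auto
    \<comment> \<open>The limits \<open>u k\<close> lie strictly inside the unit interval, so these
      finitely many conditions hold for all small \<delta>.\<close>
    have "\<forall>\<^sub>F \<delta> in at 0. \<forall>k\<in>{..T}. 0 < follow a (x + \<delta>) k \<and> follow a (x + \<delta>) k < 1"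
      using orbit(1) order_tendstoD[OF tendsto]
      by (intro eventually_ball_finite ballI eventually_conj) auto
    moreover have "\<forall>\<^sub>F \<delta> in at (0::real). \<delta> \<noteq> 0" by (simp add: eventually_at_filter)
    ultimately show "\<forall>\<^sub>F \<delta> in at 0. Z \<le> (question_mark (x + \<delta>) - question_mark x) / \<delta>"
    proof eventually_elim
      case (elim \<delta>)
      have "(51/50) ^ T / 768000 \<le> (question_mark (x + \<delta>) - question_mark (u 0)) / ((x + \<delta>) - u 0)"
      proof (rule difference_quotient_bound[of a])
        show "x + \<delta> \<noteq> u 0" using elim by (simp add: u_def)
        show "0 \<le> follow a (x + \<delta>) k \<and> follow a (x + \<delta>) k \<le> 1" if "k \<le> T" for k
          using elim that by (simp add: less_imp_le)
      qed (fact orbit u)+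
      moreover have "Z \<le> (51/50) ^ T / 768000" using T by simp
      moreover have "x + \<delta> - u 0 = \<delta>" "u 0 = x" by (simp_all add: u_def)
      ultimately show ?case by (simp only:)
    qed
  qed
qed

end
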